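(* Let $(X_j,\mathcal{B}_j)$, $j\in J$, be a (nonempty) family of ball spaces. The following assertions are equivalent: a) the ball spaces $(X_j,\mathcal{B}_j)$, $j\in J$, are (all) spherically complete; b) their box product is spherically complete; c) their topological product is spherically complete; d) their product is spherically complete. The same holds with "$\mathbf{S}_1^d$" and with "$\mathbf{S}_1^c$" in place of "spherically complete". The equivalence of a) and b) also holds for all other properties $\mathbf{S}_i$, $\mathbf{S}_i^d$, $\mathbf{S}_i^c$ ($2\leq i\leq 5$) in place of "spherically complete", and the equivalence of a) and d) also holds for $\mathbf{S}_2$, $\mathbf{S}_3$, $\mathbf{S}_4$ and $\mathbf{S}_5$ in place of "spherically complete".
   Context: A ball space $(X,\mathcal{B})$ consists of a nonempty set $X$ and a nonempty family $\mathcal{B}$ of nonempty subsets of $X$, called balls. A nest of balls is a nonempty subset of $\mathcal{B}$ totally ordered by inclusion. A directed system of balls is a nonempty collection of balls such that the intersection of any two balls in the collection contains a ball included in the collection. A centered system of balls is a nonempty collection of balls such that the intersection of any finite number of balls in the collection is nonempty. Properties of a ball space: $\mathbf{S}_1$ (= spherically complete): the intersection of each nest is nonempty. $\mathbf{S}_2$: the intersection of each nest contains a ball. $\mathbf{S}_3$: the intersection of each nest contains maximal balls (i.e. there is a ball that is maximal, under inclusion, among the balls contained in the intersection). $\mathbf{S}_4$: the intersection of each nest contains a largest ball (a ball contained in the intersection and containing every ball contained in the intersection). $\mathbf{S}_5$: the intersection of each nest is a ball. $\mathbf{S}_i^d$: same as $\mathbf{S}_i$ with "directed system" in place of "nest".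 $\mathbf{S}_i^c$: same as $\mathbf{S}_i$ with "centered system" in place of "nest". Given ball spaces $(X_j,\mathcal{B}_j)_{j\in J}$, set $X=\prod_{j\in J}X_j$ and $\widehat{\mathcal{B}}_j=\mathcal{B}_j\cup\{X_j\}$. The product is the ball space on $X$ whose balls are the sets $\prod_{j\in J}B_j$ such that for some $k\in J$, $B_k\in\mathcal{B}_k$ and $B_j=X_j$ for all $j\neq k$. The topological product is the ball space on $X$ whose balls are the sets $\prod_{j\in J}B_j$ with $B_j\in\widehat{\mathcal{B}}_j$ for all $j\in J$ and $B_j=X_j$ for all but finitely many $j$. The box product is the ball space on $X$ whose balls are the sets $\prod_{j\in J}B_j$ with $B_j\in\mathcal{B}_j$ for all $j\in J$. *)

theory Defs
  imports "HOL-Library.FuncSet"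
begin

definition ball_space :: "'a set \<Rightarrow> 'a set set \<Rightarrow> bool" where
  "ball_space X \<B> \<longleftrightarrow> X \<noteq> {} \<and> \<B> \<noteq> {} \<and> (\<forall>B\<in>\<B>. B \<noteq> {} \<and> B \<subseteq> X)"

definition nest :: "'a set set \<Rightarrow> 'a set set \<Rightarrow> bool" where
  "nest \<B> \<N> \<longleftrightarrow> \<N> \<noteq> {} \<and> \<N> \<subseteq> \<B> \<and> chain\<^sub>\<subseteq> \<N>"

definition directed_system :: "'a set set \<Rightarrow> 'a set set \<Rightarrow> bool" where
  "directed_system \<B> \<N> \<longleftrightarrow>
     \<N> \<noteq> {} \<and> \<N> \<subseteq> \<B> \<and> (\<forall>A\<in>\<N>. \<forall>B\<in>\<N>. \<exists>C\<in>\<N>. C \<subseteq> A \<inter> B)"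

definition centered_system :: "'a set set \<Rightarrow> 'a set set \<Rightarrow> bool" where
  "centered_system \<B> \<N> \<longleftrightarrow>
     \<N> \<noteq> {} \<and> \<N> \<subseteq> \<B> \<and> (\<forall>\<F>. \<F> \<subseteq> \<N> \<and> finite \<F> \<and> \<F> \<noteq> {} \<longrightarrow> \<Inter>\<F> \<noteq> {})"

text \<open>
  The properties have to be compared at two different types (that of the factors and that of
  their products), so one cannot quantify over them as predicates inside a formula.  They are
  indexed by two finite types instead: \<open>satisfies Si Nest\<close>, \<open>satisfies Si Directed\<close> and
  \<open>satisfies Si Centered\<close> are the properties $S_i$, $S_i^d$ and $S_i^c$.  None of them
  depends on the underlying set of the ball space.
\<close>

datatype system_kind = Nest | Directed | Centered

datatype level = S1 | S2 | S3 | S4 | S5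

primrec ball_system :: "system_kind \<Rightarrow> 'a set set \<Rightarrow> 'a set set \<Rightarrow> bool" where
  "ball_system Nest = nest"
| "ball_system Directed = directed_system"
| "ball_system Centered = centered_system"

primrec good_intersection :: "level \<Rightarrow> 'a set set \<Rightarrow> 'a set \<Rightarrow> bool" where
  "good_intersection S1 \<B> D \<longleftrightarrow> D \<noteq> {}"
| "good_intersection S2 \<B> D \<longleftrightarrow> (\<exists>B\<in>\<B>. B \<subseteq> D)"
| "good_intersection S3 \<B> D \<longleftrightarrow>
     (\<exists>B\<in>\<B>. B \<subseteq> D \<and> (\<forall>C\<in>\<B>. C \<subseteq> D \<and> B \<subseteq> C \<longrightarrow> C = B))"
| "good_intersection S4 \<B> D \<longleftrightarrow>
     (\<exists>B\<in>\<B>. B \<subseteq> D \<and> (\<forall>C\<in>\<B>. C \<subseteq> D \<longrightarrow> C \<subseteq> B))"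
| "good_intersection S5 \<B> D \<longleftrightarrow> D \<in> \<B>"

definition satisfies :: "level \<Rightarrow> system_kind \<Rightarrow> 'a set set \<Rightarrow> bool" where
  "satisfies i \<kappa> \<B> \<longleftrightarrow> (\<forall>\<N>. ball_system \<kappa> \<B> \<N> \<longrightarrow> good_intersection i \<B> (\<Inter>\<N>))"

abbreviation spherically_complete :: "'a set set \<Rightarrow> bool" where
  "spherically_complete \<equiv> satisfies S1 Nest"

text \<open>The three products below all have \<open>Pi\<^sub>E J X\<close> as underlying set.\<close>

definition product_balls ::
    "'i set \<Rightarrow> ('i \<Rightarrow> 'a set) \<Rightarrow> ('i \<Rightarrow> 'a set set) \<Rightarrow> ('i \<Rightarrow> 'a) set set" where
  "product_balls J X \<B> =
     {Pi\<^sub>E J B |B. \<exists>k\<in>J. B k \<in> \<B> k \<and> (\<forall>j\<in>J. j \<noteq> k \<longrightarrow> B j = X j)}"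

definition topological_product_balls ::
    "'i set \<Rightarrow> ('i \<Rightarrow> 'a set) \<Rightarrow> ('i \<Rightarrow> 'a set set) \<Rightarrow> ('i \<Rightarrow> 'a) set set" where
  "topological_product_balls J X \<B> =
     {Pi\<^sub>E J B |B. (\<forall>j\<in>J. B j \<in> \<B> j \<union> {X j}) \<and> finite {j\<in>J. B j \<noteq> X j}}"

definition box_product_balls ::
    "'i set \<Rightarrow> ('i \<Rightarrow> 'a set set) \<Rightarrow> ('i \<Rightarrow> 'a) set set" where
  "box_product_balls J \<B> = {Pi\<^sub>E J B |B. \<forall>j\<in>J. B j \<in> \<B> j}"

lemma ball_space_product:
  assumes "J \<noteq> {}" "\<forall>j\<in>J. ball_space (X j) (\<B> j)"
  shows "ball_space (Pi\<^sub>E J X) (product_balls J X \<B>)"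
proof -
  obtain k where k: "k \<in> J" using assms(1) by blast
  obtain A where A: "A \<in> \<B> k" using assms(2) k by (auto simp: ball_space_def)
  have "Pi\<^sub>E J (X(k := A)) \<in> product_balls J X \<B>"
    unfolding product_balls_def
    by (rule CollectI, rule exI[of _ "X(k := A)"]) (use k A in \<open>simp add: bexI[of _ k]\<close>)
  moreover have "B \<noteq> {} \<and> B \<subseteq> Pi\<^sub>E J X" if B: "B \<in> product_balls J X \<B>" for B
  proof -
    obtain F l where F: "B = Pi\<^sub>E J F" "l \<in> J" "F l \<in> \<B> l" "\<forall>j\<in>J. j \<noteq> l \<longrightarrow> F j = X j"
      using B unfolding product_balls_def by blast
    have "F j \<noteq> {} \<and> F j \<subseteq> X j" if "j \<in> J" for j
      using F that assms(2) by (cases "j = l") (auto simp: ball_space_def)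
    then show ?thesis unfolding F(1) by (simp add: PiE_eq_empty_iff PiE_mono)
  qed
  moreover have "Pi\<^sub>E J X \<noteq> {}" using assms(2) by (simp add: PiE_eq_empty_iff ball_space_def)
  ultimately show ?thesis unfolding ball_space_def by blast
qed

lemma ball_space_topological_product:
  assumes "\<forall>j\<in>J. ball_space (X j) (\<B> j)"
  shows "ball_space (Pi\<^sub>E J X) (topological_product_balls J X \<B>)"
proof -
  have "Pi\<^sub>E J X \<in> topological_product_balls J X \<B>"
    unfolding topological_product_balls_def by (rule CollectI, rule exI[of _ X]) simp
  moreover have "B \<noteq> {} \<and> B \<subseteq> Pi\<^sub>E J X" if B: "B \<in> topological_product_balls J X \<B>" for B
  proof -
    obtain F where F: "B = Pi\<^sub>E J F" "\<forall>j\<in>J. F j \<in> \<B> j \<union> {X j}"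
      using B unfolding topological_product_balls_def by blast
    have "F j \<noteq> {} \<and> F j \<subseteq> X j" if "j \<in> J" for j
      using F that assms by (auto simp: ball_space_def)
    then show ?thesis unfolding F(1) by (simp add: PiE_eq_empty_iff PiE_mono)
  qed
  moreover have "Pi\<^sub>E J X \<noteq> {}" using assms by (simp add: PiE_eq_empty_iff ball_space_def)
  ultimately show ?thesis unfolding ball_space_def by blast
qed

lemma ball_space_box_product:
  assumes "\<forall>j\<in>J. ball_space (X j) (\<B> j)"
  shows "ball_space (Pi\<^sub>E J X) (box_product_balls J \<B>)"
proof -
  have "\<forall>j\<in>J. \<exists>A. A \<in> \<B> j" using assms by (auto simp: ball_space_def)
  then obtain A where "\<forall>j\<in>J. A j \<in> \<B> j" by metis
  then have "Pi\<^sub>E J A \<in> box_product_balls J \<B>"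
    unfolding box_product_balls_def by (intro CollectI exI[of _ A] conjI refl)
  moreover have "B \<noteq> {} \<and> B \<subseteq> Pi\<^sub>E J X" if B: "B \<in> box_product_balls J \<B>" for B
  proof -
    obtain F where F: "B = Pi\<^sub>E J F" "\<forall>j\<in>J. F j \<in> \<B> j"
      using B unfolding box_product_balls_def by blast
    have "F j \<noteq> {} \<and> F j \<subseteq> X j" if "j \<in> J" for j
      using F that assms by (auto simp: ball_space_def)
    then show ?thesis unfolding F(1) by (simp add: PiE_eq_empty_iff PiE_mono)
  qed
  moreover have "Pi\<^sub>E J X \<noteq> {}" using assms by (simp add: PiE_eq_empty_iff ball_space_def)
  ultimately show ?thesis unfolding ball_space_def by blast
qed

end

theory Submission
  imports Defs
begin

text \<open>
  A product of nonempty sets determines its factors, and everything rests on how faithfully the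
  three notions of system (nest, directed system, centered system) travel between a product and its
  factors.  All three survive any map of sets that is monotone and keeps nonempty sets nonempty
  (\<open>ball_system_image\<close>).  Two such maps are used: the projection of a set onto a coordinate \<open>j\<close>,
  which sends a nonempty box \<open>Pi\<^sub>E J B\<close> to its side \<open>B j\<close>, and the embedding
  \<open>A \<mapsto> Pi\<^sub>E J (F(k := A))\<close> of a factor, which varies one side of a box and freezes the others.  Both commute with the intersections that occur
  (\<open>Inter_boxes\<close>, \<open>Inter_cylinders\<close>).

  \<^item> Box product.  Every condition that may be put on the intersection holds for a box iff it
    holds in each coordinate (\<open>good_intersection_box\<close>).  Projecting a system of boxes gives the
    step from the factors to the product; embedding a system of one factor, with arbitrary fixed
    balls in the other coordinates, gives the converse.

  \<^item> Topological product and product, level \<open>S1\<close>.  The projection of a system to a coordinate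
    consists of balls and possibly of the whole factor.  If the whole factor is the only member, the
    intersection is nonempty; otherwise the whole factor may be discarded without affecting the
    intersection.  So spherically complete factors have a spherically complete
    topological product.  The balls of the product are among those of the topological product, and
    each factor embeds in the product by freezing the other coordinates at \<open>X\<close>; this closes the
    circle.

  \<^item> Product, levels \<open>S2\<close> to \<open>S5\<close>, nests.  Comparable cylinders that are both proper subsets
    must restrict the same coordinate.  Hence a nest, apart from the whole space, lives in a single
    factor \<open>k\<close>, and so do all balls contained in its intersection, provided that this
    intersection is not the whole space (\<open>good_intersection_cylinder\<close>).  If it is the whole space,
    it is itself a ball and there is nothing to prove.
\<close>

section \<open>Systems of balls under maps\<close>

text \<open>
  For centered systems: finitely many members of the image come from finitely many members of the
  original system, and by monotonicity their intersection contains the image of a nonempty set.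
\<close>

lemma ball_system_image:
  assumes sys: "ball_system \<kappa> \<B> \<N>"
    and mono: "\<And>A B. A \<subseteq> B \<Longrightarrow> f A \<subseteq> f B"
    and nonempty: "\<And>A. A \<noteq> {} \<Longrightarrow> f A \<noteq> {}"
    and into: "f ` \<N> \<subseteq> \<C>"
  shows "ball_system \<kappa> \<C> (f ` \<N>)"
proof (cases \<kappa>)
  case Nest
  have "f A \<subseteq> f B \<or> f B \<subseteq> f A" if "A \<in> \<N>" "B \<in> \<N>" for A B
  proof -
    have "A \<subseteq> B \<or> B \<subseteq> A"
      using sys Nest that by (simp add: nest_def chain_subset_def)
    then show ?thesis using mono by blast
  qed
  then show ?thesis
    using sys into Nest by (simp add: nest_def chain_subset_def)
next
  case Directed
  have "\<exists>C\<in>\<N>. f C \<subseteq> f A \<inter> f B" if "A \<in> \<N>" "B \<in> \<N>" for A B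
  proof -
    have "\<exists>C\<in>\<N>. C \<subseteq> A \<inter> B"
      using sys Directed that by (simp add: directed_system_def)
    then obtain C where "C \<in> \<N>" "C \<subseteq> A \<inter> B" by blast
    then show ?thesis using mono[of C A] mono[of C B] by blast
  qed
  then show ?thesis
    using sys into Directed by (simp add: directed_system_def)
next
  case Centered
  have "\<Inter>\<F> \<noteq> {}" if \<F>: "\<F> \<subseteq> f ` \<N>" "finite \<F>" "\<F> \<noteq> {}" for \<F>
  proof -
    obtain \<G> where \<G>: "\<G> \<subseteq> \<N>" "finite \<G>" "\<F> = f ` \<G>"
      using \<F> by (meson finite_subset_image)
    then have "\<Inter>\<G> \<noteq> {}"
      using sys Centered \<F>(3) by (auto simp: centered_system_def)
    then have "f (\<Inter>\<G>) \<noteq> {}" by (rule nonempty)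
    moreover have "f (\<Inter>\<G>) \<subseteq> \<Inter>\<F>"
      unfolding \<G>(3) by (intro INT_greatest mono Inter_lower)
    ultimately show ?thesis by blast
  qed
  then show ?thesis
    using sys into Centered by (simp add: centered_system_def)
qed

lemma ball_system_nonempty: "ball_system \<kappa> \<B> \<N> \<Longrightarrow> \<N> \<noteq> {}"
  by (cases \<kappa>) (auto simp: nest_def directed_system_def centered_system_def)

lemma ball_system_subset: "ball_system \<kappa> \<B> \<N> \<Longrightarrow> \<N> \<subseteq> \<B>"
  by (cases \<kappa>) (auto simp: nest_def directed_system_def centered_system_def)

lemma ball_system_mono:
  assumes "ball_system \<kappa> \<B> \<N>" "\<N> \<subseteq> \<C>"
  shows "ball_system \<kappa> \<C> \<N>"
  using ball_system_image[OF assms(1), of "\<lambda>A. A" \<C>] assms(2) by simp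

text \<open>
  Only directedness needs an argument: a member below two proper subsets of \<open>Y\<close> cannot be \<open>Y\<close>.
\<close>

lemma ball_system_remove_top:
  assumes sys: "ball_system \<kappa> (insert Y \<B>) \<N>"
    and sub: "\<And>A. A \<in> \<B> \<Longrightarrow> A \<subseteq> Y"
    and "\<N> \<noteq> {Y}"
  shows "ball_system \<kappa> \<B> (\<N> - {Y})"
proof -
  have ne: "\<N> - {Y} \<noteq> {}" using assms(3) ball_system_nonempty[OF sys] by blast
  have into: "\<N> - {Y} \<subseteq> \<B>" using ball_system_subset[OF sys] by blast
  show ?thesis
  proof (cases \<kappa>)
    case Nest
    then show ?thesis using sys ne into by (auto simp: nest_def chain_subset_def)
  next
    case Directed
    have "\<exists>C\<in>\<N> - {Y}. C \<subseteq> A \<inter> B" if "A \<in> \<N> - {Y}" "B \<in> \<N> - {Y}" for A B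
    proof -
      have "\<exists>C\<in>\<N>. C \<subseteq> A \<inter> B"
        using sys Directed that by (simp add: directed_system_def)
      then obtain C where C: "C \<in> \<N>" "C \<subseteq> A \<inter> B" by blast
      moreover have "C \<noteq> Y" using C that into sub by blast
      ultimately show ?thesis by blast
    qed
    then show ?thesis using ne into Directed by (simp add: directed_system_def)
  next
    case Centered
    then show ?thesis using sys ne into by (auto simp: centered_system_def)
  qed
qed

lemma Inter_remove_top:
  assumes "\<N> - {Y} \<noteq> {}" "\<And>A. A \<in> \<N> \<Longrightarrow> A \<subseteq> Y"
  shows "\<Inter>(\<N> - {Y}) = \<Inter>\<N>"
  using assms by blast

lemma good_intersection_ball:
  assumes "D \<in> \<B>" "i \<noteq> S1"
  shows "good_intersection i \<B> D"
  using assms by (cases i) auto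

section \<open>Boxes and cylinders\<close>

lemma projection_box:
  assumes "\<And>j. j \<in> J \<Longrightarrow> F j \<noteq> {}" "k \<in> J"
  shows "(\<lambda>x. x k) ` Pi\<^sub>E J F = F k"
  using assms by (simp add: image_projection_PiE PiE_eq_empty_iff)

lemma box_eq_box_projections:
  assumes "\<And>j. j \<in> J \<Longrightarrow> F j \<noteq> {}"
  shows "Pi\<^sub>E J F = Pi\<^sub>E J (\<lambda>j. (\<lambda>x. x j) ` Pi\<^sub>E J F)"
  by (rule PiE_cong) (simp add: projection_box[OF assms])

lemma Inter_boxes:
  assumes "\<N> \<noteq> {}" "\<And>S. S \<in> \<N> \<Longrightarrow> S = Pi\<^sub>E J (\<lambda>j. (\<lambda>x. x j) ` S)"
  shows "\<Inter>\<N> = Pi\<^sub>E J (\<lambda>j. \<Inter>((`) (\<lambda>x. x j) ` \<N>))"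
proof
  show "\<Inter>\<N> \<subseteq> Pi\<^sub>E J (\<lambda>j. \<Inter>((`) (\<lambda>x. x j) ` \<N>))"
  proof
    fix x assume x: "x \<in> \<Inter>\<N>"
    obtain S where "S \<in> \<N>" using assms(1) by blast
    then have "x \<in> extensional J" using x assms(2) by (metis InterD IntD2 PiE_def)
    then show "x \<in> Pi\<^sub>E J (\<lambda>j. \<Inter>((`) (\<lambda>x. x j) ` \<N>))"
      using x by (auto simp: PiE_def)
  qed
  show "Pi\<^sub>E J (\<lambda>j. \<Inter>((`) (\<lambda>x. x j) ` \<N>)) \<subseteq> \<Inter>\<N>"
  proof (rule Inter_greatest)
    fix S assume S: "S \<in> \<N>"
    then have "Pi\<^sub>E J (\<lambda>j. \<Inter>((`) (\<lambda>x. x j) ` \<N>)) \<subseteq> Pi\<^sub>E J (\<lambda>j. (\<lambda>x. x j) ` S)"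
      by (intro PiE_mono) blast
    then show "Pi\<^sub>E J (\<lambda>j. \<Inter>((`) (\<lambda>x. x j) ` \<N>)) \<subseteq> S"
      using assms(2)[OF S] by simp
  qed
qed

lemma Inter_cylinders:
  assumes "\<M> \<noteq> {}" "k \<in> J"
  shows "\<Inter>((\<lambda>A. Pi\<^sub>E J (F(k := A))) ` \<M>) = Pi\<^sub>E J (F(k := \<Inter>\<M>))"
proof -
  obtain A where "A \<in> \<M>" using assms(1) by blast
  have "x \<in> \<Inter>((\<lambda>A. Pi\<^sub>E J (F(k := A))) ` \<M>) \<longleftrightarrow> x \<in> Pi\<^sub>E J (F(k := \<Inter>\<M>))" for x
  proof -
    have "x \<in> Pi\<^sub>E J (F(k := B)) \<longleftrightarrow>
        x \<in> extensional J \<and> (\<forall>j\<in>J - {k}. x j \<in> F j) \<and> x k \<in> B" for B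
      using assms(2) by (auto simp: PiE_iff)
    then show ?thesis using \<open>A \<in> \<M>\<close> by auto
  qed
  then show ?thesis by blast
qed

text \<open>
  The hypothesis that \<open>F\<close> has no empty values makes the embedding keep nonempty sets nonempty.
\<close>

lemma ball_system_cylinders:
  assumes "ball_system \<kappa> \<B> \<M>" "\<And>j. j \<in> J \<Longrightarrow> F j \<noteq> {}"
    and "\<And>A. A \<in> \<M> \<Longrightarrow> Pi\<^sub>E J (F(k := A)) \<in> \<C>"
  shows "ball_system \<kappa> \<C> ((\<lambda>A. Pi\<^sub>E J (F(k := A))) ` \<M>)"
proof (rule ball_system_image[OF assms(1)])
  show "Pi\<^sub>E J (F(k := A)) \<subseteq> Pi\<^sub>E J (F(k := B))" if "A \<subseteq> B" for A B
    using that by (intro PiE_mono) simp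
  show "Pi\<^sub>E J (F(k := A)) \<noteq> {}" if "A \<noteq> {}" for A
    using that assms(2) by (simp add: PiE_eq_empty_iff)
  show "(\<lambda>A. Pi\<^sub>E J (F(k := A))) ` \<M> \<subseteq> \<C>"
    using assms(3) by blast
qed

lemma ball_system_projection:
  assumes "ball_system \<kappa> \<C> \<N>" "\<And>S. S \<in> \<N> \<Longrightarrow> (\<lambda>x. x j) ` S \<in> \<B>"
  shows "ball_system \<kappa> \<B> ((`) (\<lambda>x. x j) ` \<N>)"
  using assms(2) by (intro ball_system_image[OF assms(1)]) auto

lemma box_subset_iff:
  assumes "\<And>j. j \<in> J \<Longrightarrow> F j \<noteq> {}"
  shows "Pi\<^sub>E J F \<subseteq> Pi\<^sub>E J G \<longleftrightarrow> (\<forall>j\<in>J. F j \<subseteq> G j)"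
  using assms by (simp add: subset_PiE PiE_eq_empty_iff)

section \<open>The box product\<close>

locale ball_space_family =
  fixes J :: "'i set" and X :: "'i \<Rightarrow> 'a set" and \<B> :: "'i \<Rightarrow> 'a set set"
  assumes ball_spaces: "\<And>j. j \<in> J \<Longrightarrow> ball_space (X j) (\<B> j)"
begin

lemma space_nonempty: "j \<in> J \<Longrightarrow> X j \<noteq> {}"
  using ball_spaces by (simp add: ball_space_def)

lemma ball_nonempty: "j \<in> J \<Longrightarrow> A \<in> \<B> j \<Longrightarrow> A \<noteq> {}"
  using ball_spaces by (auto simp: ball_space_def)

lemma ball_subset: "j \<in> J \<Longrightarrow> A \<in> \<B> j \<Longrightarrow> A \<subseteq> X j"
  using ball_spaces by (auto simp: ball_space_def)

text \<open>
  Inclusion of boxes with nonempty sides is inclusion in every coordinate, so a box is a maximal or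
  a largest ball in \<open>Pi\<^sub>E J D\<close> iff each side is one in \<open>D j\<close>.  From the box to the sides, a
  competitor \<open>C\<close> of the \<open>k\<close>-th side is tested by exchanging this side for \<open>C\<close>.  From the sides to
  the box, the axiom of choice selects a suitable ball in all coordinates at once.
\<close>

lemma good_intersection_box:
  "good_intersection i (box_product_balls J \<B>) (Pi\<^sub>E J D) \<longleftrightarrow>
     (\<forall>j\<in>J. good_intersection i (\<B> j) (D j))"
proof -
  have sub: "Pi\<^sub>E J F \<subseteq> Pi\<^sub>E J G \<longleftrightarrow> (\<forall>j\<in>J. F j \<subseteq> G j)"
    if "\<forall>j\<in>J. F j \<in> \<B> j" for F G
    using that ball_nonempty by (intro box_subset_iff) simp
  have eq: "Pi\<^sub>E J F = Pi\<^sub>E J G \<longleftrightarrow> (\<forall>j\<in>J. F j = G j)"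
    if "\<forall>j\<in>J. F j \<in> \<B> j" for F G
  proof -
    have "\<forall>j\<in>J. F j \<noteq> {}" using that ball_nonempty by simp
    then show ?thesis by (auto simp: PiE_eq_iff)
  qed
  have exchange: "\<forall>j\<in>J. (F(k := C)) j \<in> \<B> j"
    if "\<forall>j\<in>J. F j \<in> \<B> j" "C \<in> \<B> k" for F k C
    using that by simp
  have ex: "(\<exists>S\<in>box_product_balls J \<B>. S \<subseteq> Pi\<^sub>E J D \<and> P S) \<longleftrightarrow>
      (\<exists>F. (\<forall>j\<in>J. F j \<in> \<B> j) \<and> (\<forall>j\<in>J. F j \<subseteq> D j) \<and> P (Pi\<^sub>E J F))" for P
  proof -
    have "(\<exists>S\<in>box_product_balls J \<B>. S \<subseteq> Pi\<^sub>E J D \<and> P S) \<longleftrightarrow>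
        (\<exists>F. (\<forall>j\<in>J. F j \<in> \<B> j) \<and> Pi\<^sub>E J F \<subseteq> Pi\<^sub>E J D \<and> P (Pi\<^sub>E J F))"
      unfolding box_product_balls_def by blast
    then show ?thesis by (simp only: sub cong: conj_cong)
  qed
  show ?thesis
  proof (cases i)
    case S1
    then show ?thesis by (simp add: PiE_eq_empty_iff)
  next
    case S2
    have "good_intersection S2 (box_product_balls J \<B>) (Pi\<^sub>E J D) \<longleftrightarrow>
        (\<exists>F. \<forall>j\<in>J. F j \<in> \<B> j \<and> F j \<subseteq> D j)"
      using ex[of "\<lambda>_. True"] by (simp add: ball_conj_distrib)
    also have "\<dots> \<longleftrightarrow> (\<forall>j\<in>J. good_intersection S2 (\<B> j) (D j))"
      unfolding good_intersection.simps Bex_def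
      by (rule bchoice_iff[where Q = "\<lambda>j A. A \<in> \<B> j \<and> A \<subseteq> D j", symmetric])
    finally show ?thesis using S2 by simp
  next
    case S3
    let ?max = "\<lambda>j A. A \<in> \<B> j \<and> A \<subseteq> D j \<and> (\<forall>C\<in>\<B> j. C \<subseteq> D j \<and> A \<subseteq> C \<longrightarrow> C = A)"
    have "(\<forall>C\<in>box_product_balls J \<B>. C \<subseteq> Pi\<^sub>E J D \<and> Pi\<^sub>E J F \<subseteq> C \<longrightarrow> C = Pi\<^sub>E J F) \<longleftrightarrow>
        (\<forall>j\<in>J. \<forall>C\<in>\<B> j. C \<subseteq> D j \<and> F j \<subseteq> C \<longrightarrow> C = F j)" (is "?L \<longleftrightarrow> ?R")
      if F: "\<forall>j\<in>J. F j \<in> \<B> j" "\<forall>j\<in>J. F j \<subseteq> D j" for F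
    proof
      assume L: ?L
      show ?R
      proof (intro ballI impI)
        fix k C assume k: "k \<in> J" "C \<in> \<B> k" "C \<subseteq> D k \<and> F k \<subseteq> C"
        note G = exchange[OF F(1) k(2)]
        have "Pi\<^sub>E J (F(k := C)) \<in> box_product_balls J \<B>"
          using G unfolding box_product_balls_def by blast
        moreover have "Pi\<^sub>E J (F(k := C)) \<subseteq> Pi\<^sub>E J D"
          unfolding sub[OF G] using k F(2) by simp
        moreover have "Pi\<^sub>E J F \<subseteq> Pi\<^sub>E J (F(k := C))"
          unfolding sub[OF F(1)] using k by simp
        ultimately have "Pi\<^sub>E J (F(k := C)) = Pi\<^sub>E J F"
          by (intro L[rule_format] conjI)
        then have "(F(k := C)) k = F k" using k(1) unfolding eq[OF G] by blast
        then show "C = F k" by simp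
      qed
    next
      assume R: ?R
      show ?L
      proof (intro ballI impI)
        fix S assume S: "S \<in> box_product_balls J \<B>" "S \<subseteq> Pi\<^sub>E J D \<and> Pi\<^sub>E J F \<subseteq> S"
        obtain G where G: "S = Pi\<^sub>E J G" "\<forall>j\<in>J. G j \<in> \<B> j"
          using S(1) unfolding box_product_balls_def by blast
        have "\<forall>j\<in>J. G j \<subseteq> D j \<and> F j \<subseteq> G j"
          using S(2) unfolding G(1) sub[OF G(2)] sub[OF F(1)] by simp
        then have "\<forall>j\<in>J. G j = F j" using G(2) R by blast
        then show "S = Pi\<^sub>E J F" unfolding G(1) eq[OF G(2)] .
      qed
    qed
    then have "good_intersection S3 (box_product_balls J \<B>) (Pi\<^sub>E J D) \<longleftrightarrow>
        (\<exists>F. \<forall>j\<in>J. ?max j (F j))"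
      by (simp only: good_intersection.simps ex ball_conj_distrib cong: conj_cong)
    also have "\<dots> \<longleftrightarrow> (\<forall>j\<in>J. good_intersection S3 (\<B> j) (D j))"
      unfolding good_intersection.simps Bex_def by (rule bchoice_iff[where Q = ?max, symmetric])
    finally show ?thesis using S3 by simp
  next
    case S4
    let ?largest = "\<lambda>j A. A \<in> \<B> j \<and> A \<subseteq> D j \<and> (\<forall>C\<in>\<B> j. C \<subseteq> D j \<longrightarrow> C \<subseteq> A)"
    have "(\<forall>C\<in>box_product_balls J \<B>. C \<subseteq> Pi\<^sub>E J D \<longrightarrow> C \<subseteq> Pi\<^sub>E J F) \<longleftrightarrow>
        (\<forall>j\<in>J. \<forall>C\<in>\<B> j. C \<subseteq> D j \<longrightarrow> C \<subseteq> F j)" (is "?L \<longleftrightarrow> ?R")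
      if F: "\<forall>j\<in>J. F j \<in> \<B> j" "\<forall>j\<in>J. F j \<subseteq> D j" for F
    proof
      assume L: ?L
      show ?R
      proof (intro ballI impI)
        fix k C assume k: "k \<in> J" "C \<in> \<B> k" "C \<subseteq> D k"
        note G = exchange[OF F(1) k(2)]
        have "Pi\<^sub>E J (F(k := C)) \<in> box_product_balls J \<B>"
          using G unfolding box_product_balls_def by blast
        moreover have "Pi\<^sub>E J (F(k := C)) \<subseteq> Pi\<^sub>E J D"
          using k F by (simp add: sub[OF G])
        ultimately have "Pi\<^sub>E J (F(k := C)) \<subseteq> Pi\<^sub>E J F" using L by blast
        then have "(F(k := C)) k \<subseteq> F k" using k(1) unfolding sub[OF G] by blast
        then show "C \<subseteq> F k" by simp
      qed
    next
      assume R: ?R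
      show ?L
      proof (intro ballI impI)
        fix S assume S: "S \<in> box_product_balls J \<B>" "S \<subseteq> Pi\<^sub>E J D"
        obtain G where G: "S = Pi\<^sub>E J G" "\<forall>j\<in>J. G j \<in> \<B> j"
          using S(1) unfolding box_product_balls_def by blast
        have "\<forall>j\<in>J. G j \<subseteq> D j" using S(2) unfolding G(1) sub[OF G(2)] .
        then show "S \<subseteq> Pi\<^sub>E J F" using G R sub[OF G(2)] by simp
      qed
    qed
    then have "good_intersection S4 (box_product_balls J \<B>) (Pi\<^sub>E J D) \<longleftrightarrow>
        (\<exists>F. \<forall>j\<in>J. ?largest j (F j))"
      by (simp only: good_intersection.simps ex ball_conj_distrib cong: conj_cong)
    also have "\<dots> \<longleftrightarrow> (\<forall>j\<in>J. good_intersection S4 (\<B> j) (D j))"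
      unfolding good_intersection.simps Bex_def by (rule bchoice_iff[where Q = ?largest, symmetric])
    finally show ?thesis using S4 by simp
  next
    case S5
    have "Pi\<^sub>E J D \<in> box_product_balls J \<B> \<longleftrightarrow> (\<forall>j\<in>J. D j \<in> \<B> j)"
    proof
      assume "Pi\<^sub>E J D \<in> box_product_balls J \<B>"
      then obtain F where F: "Pi\<^sub>E J D = Pi\<^sub>E J F" "\<forall>j\<in>J. F j \<in> \<B> j"
        unfolding box_product_balls_def by blast
      then show "\<forall>j\<in>J. D j \<in> \<B> j" using eq[OF F(2), of D] by simp
    next
      assume "\<forall>j\<in>J. D j \<in> \<B> j"
      then show "Pi\<^sub>E J D \<in> box_product_balls J \<B>"
        unfolding box_product_balls_def by blast
    qed
    then show ?thesis using S5 by simp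
  qed
qed

theorem satisfies_box_product_iff:
  "satisfies i \<kappa> (box_product_balls J \<B>) \<longleftrightarrow> (\<forall>j\<in>J. satisfies i \<kappa> (\<B> j))"
proof
  assume box: "satisfies i \<kappa> (box_product_balls J \<B>)"
  have "\<forall>j\<in>J. \<exists>A. A \<in> \<B> j"
    using ball_spaces unfolding ball_space_def by blast
  then obtain F where F: "\<forall>j\<in>J. F j \<in> \<B> j" by (rule bchoice[THEN exE])
  show "\<forall>j\<in>J. satisfies i \<kappa> (\<B> j)"
    unfolding satisfies_def
  proof (intro ballI allI impI)
    fix k \<M> assume k: "k \<in> J" and \<M>: "ball_system \<kappa> (\<B> k) \<M>"
    have "ball_system \<kappa> (box_product_balls J \<B>) ((\<lambda>A. Pi\<^sub>E J (F(k := A))) ` \<M>)"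
    proof (rule ball_system_cylinders[OF \<M>])
      show "F j \<noteq> {}" if "j \<in> J" for j
        using that F ball_nonempty by blast
      show "Pi\<^sub>E J (F(k := A)) \<in> box_product_balls J \<B>" if "A \<in> \<M>" for A
        unfolding box_product_balls_def
        by (rule CollectI, rule exI[of _ "F(k := A)"])
          (use that F subsetD[OF ball_system_subset[OF \<M>]] in simp)
    qed
    then have "good_intersection i (box_product_balls J \<B>) (Pi\<^sub>E J (F(k := \<Inter>\<M>)))"
      unfolding Inter_cylinders[OF ball_system_nonempty[OF \<M>] k, symmetric]
      by (rule box[unfolded satisfies_def, rule_format])
    then have "good_intersection i (\<B> k) ((F(k := \<Inter>\<M>)) k)"
      using k unfolding good_intersection_box by blast
    then show "good_intersection i (\<B> k) (\<Inter>\<M>)" by simp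
  qed
next
  assume factors: "\<forall>j\<in>J. satisfies i \<kappa> (\<B> j)"
  show "satisfies i \<kappa> (box_product_balls J \<B>)"
    unfolding satisfies_def
  proof (intro allI impI)
    fix \<N> assume \<N>: "ball_system \<kappa> (box_product_balls J \<B>) \<N>"
    have box: "S = Pi\<^sub>E J (\<lambda>j. (\<lambda>x. x j) ` S)"
      and sides: "j \<in> J \<Longrightarrow> (\<lambda>x. x j) ` S \<in> \<B> j"
      if "S \<in> \<N>" for S j
    proof -
      have "S \<in> box_product_balls J \<B>" using ball_system_subset[OF \<N>] that by (rule subsetD)
      then obtain F where F: "S = Pi\<^sub>E J F" "\<forall>j\<in>J. F j \<in> \<B> j"
        unfolding box_product_balls_def by blast
      have ne: "F j \<noteq> {}" if "j \<in> J" for j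
        using F(2) that ball_nonempty by blast
      show "S = Pi\<^sub>E J (\<lambda>j. (\<lambda>x. x j) ` S)"
        unfolding F(1) using ne by (rule box_eq_box_projections)
      show "(\<lambda>x. x j) ` S \<in> \<B> j" if "j \<in> J"
        using F(2) that unfolding F(1) by (simp add: projection_box[OF ne])
    qed
    have "good_intersection i (\<B> j) (\<Inter>((`) (\<lambda>x. x j) ` \<N>))" if j: "j \<in> J" for j
    proof -
      have "ball_system \<kappa> (\<B> j) ((`) (\<lambda>x. x j) ` \<N>)"
        by (rule ball_system_projection[OF \<N> sides[OF _ j]])
      then show ?thesis by (rule factors[rule_format, OF j, unfolded satisfies_def, rule_format])
    qed
    moreover have "\<Inter>\<N> = Pi\<^sub>E J (\<lambda>j. \<Inter>((`) (\<lambda>x. x j) ` \<N>))"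
      by (rule Inter_boxes[OF ball_system_nonempty[OF \<N>] box])
    ultimately show "good_intersection i (box_product_balls J \<B>) (\<Inter>\<N>)"
      by (simp add: good_intersection_box)
  qed
qed

section \<open>Nonempty intersections in the topological product and the product\<close>

lemma product_balls_eq_cylinders:
  "product_balls J X \<B> = {Pi\<^sub>E J (X(k := A)) |k A. k \<in> J \<and> A \<in> \<B> k}"
proof (rule set_eqI, rule iffI)
  fix S assume "S \<in> product_balls J X \<B>"
  then obtain F k where F: "S = Pi\<^sub>E J F" "k \<in> J" "F k \<in> \<B> k" "\<forall>j\<in>J. j \<noteq> k \<longrightarrow> F j = X j"
    unfolding product_balls_def by blast
  have "Pi\<^sub>E J F = Pi\<^sub>E J (X(k := F k))" using F(4) by (intro PiE_cong) simp
  then have "S = Pi\<^sub>E J (X(k := F k))" using F(1) by simp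
  then show "S \<in> {Pi\<^sub>E J (X(k := A)) |k A. k \<in> J \<and> A \<in> \<B> k}" using F by blast
next
  fix S assume "S \<in> {Pi\<^sub>E J (X(k := A)) |k A. k \<in> J \<and> A \<in> \<B> k}"
  then obtain k A where "S = Pi\<^sub>E J (X(k := A))" "k \<in> J" "A \<in> \<B> k" by blast
  then show "S \<in> product_balls J X \<B>"
    unfolding product_balls_def
    by (intro CollectI exI[of _ "X(k := A)"] conjI bexI[of _ k]) simp_all
qed

lemma cylinder_in_product_balls:
  "k \<in> J \<Longrightarrow> A \<in> \<B> k \<Longrightarrow> Pi\<^sub>E J (X(k := A)) \<in> product_balls J X \<B>"
  unfolding product_balls_eq_cylinders by blast

lemma product_balls_subset_topological:
  "product_balls J X \<B> \<subseteq> topological_product_balls J X \<B>"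
proof
  fix S assume "S \<in> product_balls J X \<B>"
  then obtain k A where S: "S = Pi\<^sub>E J (X(k := A))" "k \<in> J" "A \<in> \<B> k"
    unfolding product_balls_eq_cylinders by blast
  moreover have "finite {j \<in> J. (X(k := A)) j \<noteq> X j}"
    by (rule finite_subset[of _ "{k}"]) auto
  ultimately show "S \<in> topological_product_balls J X \<B>"
    unfolding topological_product_balls_def
    by (intro CollectI exI[of _ "X(k := A)"] conjI) simp_all
qed

lemma ball_system_embed_factor:
  assumes "ball_system \<kappa> (\<B> k) \<M>" "k \<in> J"
  shows "ball_system \<kappa> (product_balls J X \<B>) ((\<lambda>A. Pi\<^sub>E J (X(k := A))) ` \<M>)"
  using space_nonempty cylinder_in_product_balls[OF assms(2)]
    subsetD[OF ball_system_subset[OF assms(1)]]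
  by (intro ball_system_cylinders[OF assms(1)]) simp_all

lemma topological_ball_is_box:
  assumes "S \<in> topological_product_balls J X \<B>"
  shows "S = Pi\<^sub>E J (\<lambda>j. (\<lambda>x. x j) ` S)"
    and "j \<in> J \<Longrightarrow> (\<lambda>x. x j) ` S \<in> insert (X j) (\<B> j)"
proof -
  obtain F where F: "S = Pi\<^sub>E J F" "\<forall>j\<in>J. F j \<in> \<B> j \<union> {X j}"
    using assms unfolding topological_product_balls_def by blast
  have ne: "F j \<noteq> {}" if "j \<in> J" for j
    using that F(2) ball_nonempty space_nonempty by blast
  show "S = Pi\<^sub>E J (\<lambda>j. (\<lambda>x. x j) ` S)"
    unfolding F(1) using ne by (rule box_eq_box_projections)
  show "(\<lambda>x. x j) ` S \<in> insert (X j) (\<B> j)" if "j \<in> J"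
    using that F(2) unfolding F(1) by (simp add: projection_box[OF ne])
qed

lemma S1_topological_product:
  assumes factors: "\<forall>j\<in>J. satisfies S1 \<kappa> (\<B> j)"
  shows "satisfies S1 \<kappa> (topological_product_balls J X \<B>)"
  unfolding satisfies_def
proof (intro allI impI)
  fix \<N> assume \<N>: "ball_system \<kappa> (topological_product_balls J X \<B>) \<N>"
  note box = topological_ball_is_box[OF subsetD[OF ball_system_subset[OF \<N>]]]
  have "\<Inter>((`) (\<lambda>x. x j) ` \<N>) \<noteq> {}" if j: "j \<in> J" for j
  proof (cases "(`) (\<lambda>x. x j) ` \<N> = {X j}")
    case True
    then show ?thesis using space_nonempty[OF j] by simp
  next
    case False
    let ?P = "(`) (\<lambda>x. x j) ` \<N>"
    have sys: "ball_system \<kappa> (insert (X j) (\<B> j)) ?P"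
      using box(2)[OF _ j] by (rule ball_system_projection[OF \<N>])
    have proper: "ball_system \<kappa> (\<B> j) (?P - {X j})"
      using sys ball_subset[OF j] False by (rule ball_system_remove_top)
    have same: "\<Inter>(?P - {X j}) = \<Inter>?P"
    proof (rule Inter_remove_top)
      show "?P - {X j} \<noteq> {}" using proper by (rule ball_system_nonempty)
      show "A \<subseteq> X j" if "A \<in> ?P" for A
        using that ball_system_subset[OF sys] ball_subset[OF j] by blast
    qed
    have "good_intersection S1 (\<B> j) (\<Inter>(?P - {X j}))"
      using proper by (rule factors[rule_format, OF j, unfolded satisfies_def, rule_format])
    then show ?thesis unfolding same by simp
  qed
  then have "Pi\<^sub>E J (\<lambda>j. \<Inter>((`) (\<lambda>x. x j) ` \<N>)) \<noteq> {}"
    by (simp only: PiE_eq_empty_iff) blast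
  then show "good_intersection S1 (topological_product_balls J X \<B>) (\<Inter>\<N>)"
    using Inter_boxes[OF ball_system_nonempty[OF \<N>] box(1)] by simp
qed

lemma S1_product_if_S1_topological_product:
  assumes "satisfies S1 \<kappa> (topological_product_balls J X \<B>)"
  shows "satisfies S1 \<kappa> (product_balls J X \<B>)"
  unfolding satisfies_def
proof (intro allI impI)
  fix \<N> assume \<N>: "ball_system \<kappa> (product_balls J X \<B>) \<N>"
  have "ball_system \<kappa> (topological_product_balls J X \<B>) \<N>"
    using ball_system_subset[OF \<N>] product_balls_subset_topological
    by (intro ball_system_mono[OF \<N>]) blast
  then show "good_intersection S1 (product_balls J X \<B>) (\<Inter>\<N>)"
    using assms by (simp add: satisfies_def)
qed

lemma S1_factors_if_S1_product:
  assumes "satisfies S1 \<kappa> (product_balls J X \<B>)" "k \<in> J"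
  shows "satisfies S1 \<kappa> (\<B> k)"
  unfolding satisfies_def
proof (intro allI impI)
  fix \<M> assume \<M>: "ball_system \<kappa> (\<B> k) \<M>"
  have "good_intersection S1 (product_balls J X \<B>) (Pi\<^sub>E J (X(k := \<Inter>\<M>)))"
    using ball_system_embed_factor[OF \<M> assms(2)]
    unfolding Inter_cylinders[OF ball_system_nonempty[OF \<M>] assms(2), symmetric]
    by (rule assms(1)[unfolded satisfies_def, rule_format])
  then have "Pi\<^sub>E J (X(k := \<Inter>\<M>)) \<noteq> {}" by simp
  then have "(X(k := \<Inter>\<M>)) k \<noteq> {}"
    using assms(2) unfolding PiE_eq_empty_iff by blast
  then show "good_intersection S1 (\<B> k) (\<Inter>\<M>)" by simp
qed

theorem S1_topological_product_iff:
  "satisfies S1 \<kappa> (topological_product_balls J X \<B>) \<longleftrightarrow> (\<forall>j\<in>J. satisfies S1 \<kappa> (\<B> j))"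
  using S1_topological_product S1_product_if_S1_topological_product S1_factors_if_S1_product
  by blast

theorem S1_product_iff:
  "satisfies S1 \<kappa> (product_balls J X \<B>) \<longleftrightarrow> (\<forall>j\<in>J. satisfies S1 \<kappa> (\<B> j))"
  using S1_topological_product S1_product_if_S1_topological_product S1_factors_if_S1_product
  by blast

section \<open>Nests in the product\<close>

lemma cylinder_subset_iff:
  assumes "k \<in> J" "A \<noteq> {}"
  shows "Pi\<^sub>E J (X(k := A)) \<subseteq> Pi\<^sub>E J (X(k := C)) \<longleftrightarrow> A \<subseteq> C"
  using assms space_nonempty by (subst box_subset_iff) auto

text \<open>
  Over the coordinate \<open>l\<close> the smaller cylinder is the full factor \<open>X l\<close>.
\<close>

lemma cylinder_subset_other_coordinate:
  assumes "Pi\<^sub>E J (X(k := A)) \<subseteq> Pi\<^sub>E J (X(l := C))" "l \<in> J" "k \<noteq> l" "A \<noteq> {}"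
  shows "X l \<subseteq> C"
proof -
  have "\<forall>j\<in>J. (X(k := A)) j \<subseteq> (X(l := C)) j"
    using assms(1) by (subst (asm) box_subset_iff) (use space_nonempty assms(4) in auto)
  then have "(X(k := A)) l \<subseteq> (X(l := C)) l" using assms(2) by blast
  then show ?thesis using assms(3) by simp
qed

text \<open>
  A ball of the product inside a cylinder whose side \<open>D\<close> is proper restricts the same coordinate.
  So below that cylinder the balls of the product are ordered like the balls of \<open>\<B> k\<close> below \<open>D\<close>.
\<close>

lemma good_intersection_cylinder:
  assumes k: "k \<in> J" and proper: "\<not> X k \<subseteq> D" and i: "i \<noteq> S1"
  shows "good_intersection i (product_balls J X \<B>) (Pi\<^sub>E J (X(k := D))) \<longleftrightarrow>
         good_intersection i (\<B> k) D"
proof -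
  let ?cyl = "\<lambda>A. Pi\<^sub>E J (X(k := A))"
  have sub: "?cyl A \<subseteq> ?cyl C \<longleftrightarrow> A \<subseteq> C" if "A \<in> \<B> k" for A C
    using that k ball_nonempty by (intro cylinder_subset_iff)
  have inj: "?cyl A = ?cyl C \<longleftrightarrow> A = C" if "A \<in> \<B> k" "C \<in> \<B> k" for A C
    by (simp only: set_eq_subset sub that)
  have below: "S \<in> product_balls J X \<B> \<and> S \<subseteq> ?cyl D \<longleftrightarrow>
      (\<exists>A. (A \<in> \<B> k \<and> A \<subseteq> D) \<and> S = ?cyl A)" for S
  proof
    assume "S \<in> product_balls J X \<B> \<and> S \<subseteq> ?cyl D"
    then obtain l A where S: "S = Pi\<^sub>E J (X(l := A))" "l \<in> J" "A \<in> \<B> l"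
      and SD: "Pi\<^sub>E J (X(l := A)) \<subseteq> ?cyl D"
      unfolding product_balls_eq_cylinders by blast
    have "l = k"
    proof (rule ccontr)
      assume "l \<noteq> k"
      from cylinder_subset_other_coordinate[OF SD k this ball_nonempty[OF S(2,3)]]
      show False using proper by contradiction
    qed
    then have "A \<in> \<B> k" "A \<subseteq> D" "S = ?cyl A"
      using S SD sub[of A D] by simp_all
    then show "\<exists>A. (A \<in> \<B> k \<and> A \<subseteq> D) \<and> S = ?cyl A" by (intro exI conjI)
  next
    assume "\<exists>A. (A \<in> \<B> k \<and> A \<subseteq> D) \<and> S = ?cyl A"
    then obtain A where A: "A \<in> \<B> k" "A \<subseteq> D" and S: "S = ?cyl A" by (elim exE conjE)
    show "S \<in> product_balls J X \<B> \<and> S \<subseteq> ?cyl D"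
      unfolding S sub[OF A(1)] using cylinder_in_product_balls[OF k A(1)] A(2) by (rule conjI)
  qed
  have ex: "(\<exists>S\<in>product_balls J X \<B>. S \<subseteq> ?cyl D \<and> P S) \<longleftrightarrow>
      (\<exists>A\<in>\<B> k. A \<subseteq> D \<and> P (?cyl A))" for P
    by (simp only: Bex_def conj_assoc[symmetric] below) blast
  have all: "(\<forall>S\<in>product_balls J X \<B>. S \<subseteq> ?cyl D \<longrightarrow> P S) \<longleftrightarrow>
      (\<forall>A\<in>\<B> k. A \<subseteq> D \<longrightarrow> P (?cyl A))" for P
    by (simp only: Ball_def imp_conjL[symmetric] below) blast
  show ?thesis
  proof (cases i)
    case S1
    with i show ?thesis by simp
  next
    case S2
    then show ?thesis using ex[of "\<lambda>_. True"] by simp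
  next
    case S3
    have "good_intersection S3 (product_balls J X \<B>) (?cyl D) \<longleftrightarrow>
        (\<exists>B\<in>\<B> k. B \<subseteq> D \<and> (\<forall>C\<in>\<B> k. C \<subseteq> D \<longrightarrow> ?cyl B \<subseteq> ?cyl C \<longrightarrow> ?cyl C = ?cyl B))"
      by (simp only: good_intersection.simps ex all imp_conjL)
    also have "\<dots> \<longleftrightarrow> good_intersection S3 (\<B> k) D"
      unfolding good_intersection.simps imp_conjL
      by (intro bex_cong conj_cong ball_cong imp_cong refl) (simp_all only: sub inj)
    finally show ?thesis using S3 by simp
  next
    case S4
    have "good_intersection S4 (product_balls J X \<B>) (?cyl D) \<longleftrightarrow>
        (\<exists>B\<in>\<B> k. B \<subseteq> D \<and> (\<forall>C\<in>\<B> k. C \<subseteq> D \<longrightarrow> ?cyl C \<subseteq> ?cyl B))"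
      by (simp only: good_intersection.simps ex all)
    also have "\<dots> \<longleftrightarrow> good_intersection S4 (\<B> k) D"
      unfolding good_intersection.simps
      by (intro bex_cong conj_cong ball_cong imp_cong refl) (simp_all only: sub)
    finally show ?thesis using S4 by simp
  next
    case S5
    have "?cyl D \<in> product_balls J X \<B> \<longleftrightarrow> D \<in> \<B> k"
    proof
      assume "?cyl D \<in> product_balls J X \<B>"
      then have "\<exists>A. (A \<in> \<B> k \<and> A \<subseteq> D) \<and> ?cyl D = ?cyl A"
        by (intro below[THEN iffD1] conjI subset_refl)
      then obtain A where A: "A \<in> \<B> k" "A \<subseteq> D" "?cyl D = ?cyl A" by (elim exE conjE)
      then have "D \<noteq> {}" using ball_nonempty[OF k A(1)] by auto
      then have "D \<subseteq> A" using cylinder_subset_iff[OF k, of D A] A(3) by simp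
      then show "D \<in> \<B> k" using A(1,2) by (simp add: subset_antisym)
    next
      assume "D \<in> \<B> k"
      then show "?cyl D \<in> product_balls J X \<B>" by (rule cylinder_in_product_balls[OF k])
    qed
    then show ?thesis using S5 by simp
  qed
qed

text \<open>
  The proper balls of a nest all restrict one coordinate \<open>k\<close>, so their sides form a nest in
  \<open>\<B> k\<close> whose intersection is proper.  If there is no proper ball, the intersection is the whole
  space, which as the only member of the nest is a ball.
\<close>

lemma product_nest_if_factors:
  assumes factors: "\<forall>j\<in>J. satisfies i Nest (\<B> j)" and i: "i \<noteq> S1"
  shows "satisfies i Nest (product_balls J X \<B>)"
  unfolding satisfies_def
proof (intro allI impI)
  fix \<N> assume \<N>: "ball_system Nest (product_balls J X \<B>) \<N>"
  show "good_intersection i (product_balls J X \<B>) (\<Inter>\<N>)"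
  proof (cases "\<N> = {Pi\<^sub>E J X}")
    case True
    then have "\<Inter>\<N> \<in> product_balls J X \<B>" using ball_system_subset[OF \<N>] by simp
    then show ?thesis using i by (rule good_intersection_ball)
  next
    case False
    then obtain S where S: "S \<in> \<N>" "S \<noteq> Pi\<^sub>E J X"
      using ball_system_nonempty[OF \<N>] by blast
    then obtain k A where k: "k \<in> J" and A: "A \<in> \<B> k" "S = Pi\<^sub>E J (X(k := A))"
      using ball_system_subset[OF \<N>] unfolding product_balls_eq_cylinders by blast
    have A_proper: "A \<noteq> X k" using A(2) S(2) by auto
    let ?cyl = "\<lambda>A. Pi\<^sub>E J (X(k := A))"
    \<comment> \<open>Comparison with \<open>S\<close> forces a ball that restricts another coordinate to be the whole space.\<close>
    have single: "\<exists>C\<in>insert (X k) (\<B> k). T = ?cyl C" if T: "T \<in> \<N>" for T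
    proof -
      obtain l C where l: "l \<in> J" "C \<in> \<B> l" "T = Pi\<^sub>E J (X(l := C))"
        using T ball_system_subset[OF \<N>] unfolding product_balls_eq_cylinders by blast
      show ?thesis
      proof (cases "l = k")
        case True
        then show ?thesis using l by blast
      next
        case False
        have "S \<subseteq> T \<or> T \<subseteq> S"
          using \<N> S(1) T by (auto simp: nest_def chain_subset_def)
        moreover have "\<not> T \<subseteq> S"
        proof
          assume "T \<subseteq> S"
          then have "X k \<subseteq> A"
            using cylinder_subset_other_coordinate[of l C k A] l A k False ball_nonempty by auto
          then show False using A_proper ball_subset[OF k A(1)] by blast
        qed
        ultimately have "X l \<subseteq> C"
          using cylinder_subset_other_coordinate[of k A l C] l A k False ball_nonempty by auto
        then have "C = X l" using ball_subset[OF l(1,2)] by blast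
        then have "T = ?cyl (X k)" using l(3) by simp
        then show ?thesis by blast
      qed
    qed
    have sides: "T = ?cyl ((\<lambda>x. x k) ` T)" "(\<lambda>x. x k) ` T \<in> insert (X k) (\<B> k)"
      if T: "T \<in> \<N>" for T
    proof -
      obtain C where C: "C \<in> insert (X k) (\<B> k)" "T = ?cyl C" using single[OF T] by blast
      have "(\<lambda>x. x k) ` T = (X(k := C)) k"
        unfolding C(2) using C(1) k space_nonempty ball_nonempty
        by (intro projection_box) auto
      then have "(\<lambda>x. x k) ` T = C" by simp
      then show "T = ?cyl ((\<lambda>x. x k) ` T)" "(\<lambda>x. x k) ` T \<in> insert (X k) (\<B> k)"
        using C by simp_all
    qed
    let ?P = "(`) (\<lambda>x. x k) ` \<N>"
    have sys: "ball_system Nest (insert (X k) (\<B> k)) ?P"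
      using sides(2) by (rule ball_system_projection[OF \<N>])
    have "?P \<noteq> {X k}"
    proof
      assume "?P = {X k}"
      moreover have "(\<lambda>x. x k) ` S \<in> ?P" using S(1) by (rule imageI)
      ultimately have "(\<lambda>x. x k) ` S = X k" by simp
      then have "S = ?cyl (X k)" using sides(1)[OF S(1)] by simp
      then show False using S(2) by simp
    qed
    then have nest: "ball_system Nest (\<B> k) (?P - {X k})"
      using sys ball_subset[OF k] by (intro ball_system_remove_top)
    have P_Inter: "\<Inter>(?P - {X k}) = \<Inter>?P"
    proof (rule Inter_remove_top)
      show "?P - {X k} \<noteq> {}" using nest by (rule ball_system_nonempty)
      show "B \<subseteq> X k" if "B \<in> ?P" for B
        using that ball_system_subset[OF sys] ball_subset[OF k] by blast
    qed
    have "\<not> X k \<subseteq> \<Inter>(?P - {X k})"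
    proof
      assume below_all: "X k \<subseteq> \<Inter>(?P - {X k})"
      obtain B where B: "B \<in> ?P - {X k}"
        using ball_system_nonempty[OF nest] by (auto simp only: ex_in_conv[symmetric])
      have "X k \<subseteq> B" using below_all Inter_lower[OF B] by (rule subset_trans)
      moreover have "B \<subseteq> X k" using ball_subset[OF k subsetD[OF ball_system_subset[OF nest] B]] .
      ultimately show False using B by simp
    qed
    moreover have "good_intersection i (\<B> k) (\<Inter>(?P - {X k}))"
      using factors k nest by (simp add: satisfies_def)
    ultimately have "good_intersection i (product_balls J X \<B>) (?cyl (\<Inter>(?P - {X k})))"
      by (rule good_intersection_cylinder[OF k _ i, THEN iffD2])
    moreover have "?cyl ` ?P = \<N>"
    proof -
      have "(\<lambda>T. ?cyl ((\<lambda>x. x k) ` T)) ` \<N> = (\<lambda>T. T) ` \<N>"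
        by (rule image_cong[OF refl]) (rule sides(1)[symmetric])
      then show ?thesis by (simp only: image_image image_ident)
    qed
    then have "\<Inter>\<N> = ?cyl (\<Inter>?P)"
      using Inter_cylinders[OF ball_system_nonempty[OF sys] k, of X] by simp
    ultimately show ?thesis using P_Inter by simp
  qed
qed

text \<open>
  The intersection of the embedded nest contains balls restricting another coordinate only when it
  is the whole space.  Then the original nest is \<open>{X k}\<close>, and \<open>X k\<close> is itself a ball.
\<close>

lemma factors_if_product_nest:
  assumes prod: "satisfies i Nest (product_balls J X \<B>)" and i: "i \<noteq> S1" and k: "k \<in> J"
  shows "satisfies i Nest (\<B> k)"
  unfolding satisfies_def
proof (intro allI impI)
  fix \<M> assume \<M>: "ball_system Nest (\<B> k) \<M>"
  show "good_intersection i (\<B> k) (\<Inter>\<M>)"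
  proof (cases "X k \<subseteq> \<Inter>\<M>")
    case True
    then have "A = X k" if "A \<in> \<M>" for A
      using that ball_system_subset[OF \<M>] ball_subset[OF k] by blast
    then have "\<M> = {X k}" using ball_system_nonempty[OF \<M>] by blast
    then have "\<Inter>\<M> \<in> \<B> k" using ball_system_subset[OF \<M>] by simp
    then show ?thesis using i by (rule good_intersection_ball)
  next
    case False
    have "good_intersection i (product_balls J X \<B>) (Pi\<^sub>E J (X(k := \<Inter>\<M>)))"
      using ball_system_embed_factor[OF \<M> k]
      unfolding Inter_cylinders[OF ball_system_nonempty[OF \<M>] k, symmetric]
      by (rule prod[unfolded satisfies_def, rule_format])
    then show ?thesis by (simp only: good_intersection_cylinder[OF k False i])
  qed
qed

theorem product_nest_iff:
  "i \<noteq> S1 \<Longrightarrow>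
     satisfies i Nest (product_balls J X \<B>) \<longleftrightarrow> (\<forall>j\<in>J. satisfies i Nest (\<B> j))"
  using product_nest_if_factors factors_if_product_nest by blast

end

section \<open>The equivalences\<close>

theorem theorem8p3:
  fixes J :: "'i set" and X :: "'i \<Rightarrow> 'a set" and \<B> :: "'i \<Rightarrow> 'a set set"
  assumes "J \<noteq> {}"
    and "\<forall>j\<in>J. ball_space (X j) (\<B> j)"
  shows
    "((\<forall>j\<in>J. spherically_complete (\<B> j)) \<longleftrightarrow>
        spherically_complete (box_product_balls J \<B>)) \<and>
     ((\<forall>j\<in>J. spherically_complete (\<B> j)) \<longleftrightarrow>
        spherically_complete (topological_product_balls J X \<B>)) \<and>
     ((\<forall>j\<in>J. spherically_complete (\<B> j)) \<longleftrightarrow>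
        spherically_complete (product_balls J X \<B>)) \<and>
     (\<forall>\<kappa>\<in>{Directed, Centered}.
       ((\<forall>j\<in>J. satisfies S1 \<kappa> (\<B> j)) \<longleftrightarrow> satisfies S1 \<kappa> (box_product_balls J \<B>)) \<and>
       ((\<forall>j\<in>J. satisfies S1 \<kappa> (\<B> j)) \<longleftrightarrow> satisfies S1 \<kappa> (topological_product_balls J X \<B>)) \<and>
       ((\<forall>j\<in>J. satisfies S1 \<kappa> (\<B> j)) \<longleftrightarrow> satisfies S1 \<kappa> (product_balls J X \<B>))) \<and>
     (\<forall>i\<in>{S2, S3, S4, S5}. \<forall>\<kappa>\<in>{Nest, Directed, Centered}.
       (\<forall>j\<in>J. satisfies i \<kappa> (\<B> j)) \<longleftrightarrow> satisfies i \<kappa> (box_product_balls J \<B>)) \<and>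
     (\<forall>i\<in>{S2, S3, S4, S5}.
       (\<forall>j\<in>J. satisfies i Nest (\<B> j)) \<longleftrightarrow> satisfies i Nest (product_balls J X \<B>))"
proof -
  interpret ball_space_family J X \<B>
    by unfold_locales (use assms(2) in blast)
  show ?thesis
    by (simp add: satisfies_box_product_iff S1_topological_product_iff S1_product_iff
        product_nest_iff)
qed

end
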